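(* Let $R$ be a commutative ring with unity, let $m\ge1$ be an integer, let $n\in\mathbb N$, and let $\lambda_1:\mathbb N\times\mathbb Z\to R$ have triangular support of order $m$. Suppose that, for this fixed $n$, there exist coefficients $\lambda_3(n,k)\in R$ ($0\le k\le w_m(n)$) satisfying: (a) $\displaystyle\sum_{b=0}^{t}\lambda_3(n,b)\,\lambda_1(n-mb,t-b)=0$ for all $1\le t\le w_m(n)$; (b) $\lambda_1(n,0)\,\lambda_3(n,0)=1$; (c) $\lambda_1(n-im,0)\in R^\times$ for all $1\le i\le w_m(n)$. Then, for each $1\le k\le w_m(n)$, $$\lambda_3(n,k)=(-1)^k\,\frac{\det A_k}{\prod_{i=0}^{k}\lambda_1(n-im,0)},$$ where $A_k=(a_{ij})_{1\le i,j\le k}$ is the $k\times k$ lower Hessenberg matrix with entries $a_{ij}=\lambda_1\bigl(n-(j-1)m,\,i-j+1\bigr)$ if $j\le i+1$ and $a_{ij}=0$ if $j>i+1$, that is, $$A_k=\begin{bmatrix} \lambda_1(n,1)&\lambda_1(n-m,0)&0&\cdots&0\\ \lambda_1(n,2)&\lambda_1(n-m,1)&\lambda_1(n-2m,0)&\cdots&0\\ \lambda_1(n,3)&\lambda_1(n-m,2)&\lambda_1(n-2m,1)&\ddots&\vdots\\ \vdots&\vdots&\vdots&\ddots&\lambda_1(n-(k-1)m,0)\\ \lambda_1(n,k)&\lambda_1(n-m,k-1)&\lambda_1(n-2m,k-2)&\cdots&\lambda_1(n-(k-1)m,1) \end{bmatrix}.$$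
   Context: $\mathbb N=\{0,1,2,\dots\}$, $w_m(n)=\lfloor n/m\rfloor$, and $R^\times$ is the group of units of $R$. A family $\lambda:\mathbb N\times\mathbb Z\to R$ has triangular support of order $m$ if $\lambda(n,k)=0$ whenever $k<0$ or $k>w_m(n)$. Division by a unit $u$ of $R$ means multiplication by $u^{-1}$. *)

theory Defs
  imports "Jordan_Normal_Form.Determinant"
begin

definition w :: "nat \<Rightarrow> nat \<Rightarrow> nat" where
  "w m n = n div m"

definition triangular_support :: "nat \<Rightarrow> (nat \<Rightarrow> int \<Rightarrow> 'a::zero) \<Rightarrow> bool" where
  "triangular_support m l \<longleftrightarrow> (\<forall>n k. k < 0 \<or> k > int (w m n) \<longrightarrow> l n k = 0)"

(* Meaningful only when u is a unit, i.e. u dvd 1; the inverse is then unique, see unit_inv_eq. *)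
definition unit_inv :: "'a::comm_ring_1 \<Rightarrow> 'a" where
  "unit_inv u = (THE v. u * v = 1)"

definition unit_divide :: "'a::comm_ring_1 \<Rightarrow> 'a \<Rightarrow> 'a" where
  "unit_divide x u = x * unit_inv u"

lemma unit_inv_eq:
  fixes u v :: "'a::comm_ring_1"
  assumes "u * v = 1"
  shows "unit_inv u = v"
  unfolding unit_inv_def
proof (rule the_equality)
  show "u * v = 1" by (fact assms)
  fix v' assume "u * v' = 1"
  then have "v' = v' * (u * v)" "v = v * (u * v')" using assms by simp_all
  then show "v' = v" by (metis mult.commute mult.left_commute)
qed

lemma unit_inv_right:
  fixes u :: "'a::comm_ring_1"
  assumes "u dvd 1"
  shows "u * unit_inv u = 1"
  using assms unit_inv_eq by (metis dvdE)

(* Entries indexed from 1. Natural-number subtraction does not truncate in the intended range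
   1 <= j <= k <= w m n, where (j - 1) * m <= n. *)
definition hess_entry :: "nat \<Rightarrow> (nat \<Rightarrow> int \<Rightarrow> 'a::comm_ring_1) \<Rightarrow> nat \<Rightarrow> nat \<Rightarrow> nat \<Rightarrow> 'a" where
  "hess_entry m l n i j =
     (if j \<le> i + 1 then l (n - (j - 1) * m) (int i - int j + 1) else 0)"

(* Matrix positions of the type mat start at 0, hence the shift. *)
definition hess_mat :: "nat \<Rightarrow> (nat \<Rightarrow> int \<Rightarrow> 'a::comm_ring_1) \<Rightarrow> nat \<Rightarrow> nat \<Rightarrow> 'a mat" where
  "hess_mat m l n k = mat k k (\<lambda>(i, j). hess_entry m l n (i + 1) (j + 1))"

end

theory Submission
  imports Defs
begin

text \<open>
  Condition (a) together with (b) says that the vector of the values \<open>\<lambda>\<^sub>3(n,0), \<dots>, \<lambda>\<^sub>3(n,k)\<close> solves a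
  linear system \<open>L x = e\<^sub>0\<close>, where \<open>L\<close> is lower triangular with diagonal entries \<open>\<lambda>\<^sub>1(n - im, 0)\<close>.
  The Hessenberg matrix is what remains of \<open>L\<close> after deleting the first row and the last column,
  so the formula is Cramer's rule for the last coordinate of \<open>x\<close>.
\<close>

text \<open>Replace the last column of \<open>A\<close> by the right-hand side and expand along it:
  only the top entry survives, with cofactor sign \<open>(-1) ^ (0 + k)\<close>. Its minor omits the
  replaced column, so it is a minor of \<open>A\<close> itself. No division occurs, hence any
  commutative ring will do.\<close>

lemma last_coordinate_of_unit_vec_solution:
  fixes A :: "'a::comm_ring_1 mat"
  assumes A: "A \<in> carrier_mat (Suc k) (Suc k)" and x: "x \<in> carrier_vec (Suc k)"
    and sol: "A *\<^sub>v x = unit_vec (Suc k) 0"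
  shows "x $ k * det A = (-1) ^ k * det (mat_delete A 0 k)"
proof -
  define B where "B = replace_col A (unit_vec (Suc k) 0) k"
  have B: "B \<in> carrier_mat (Suc k) (Suc k)"
    using A by (auto simp: B_def replace_col_def)
  have "mat_delete B 0 k = mat_delete A 0 k"
    using A by (intro eq_matI) (auto simp: mat_delete_def B_def replace_col_def)
  moreover have "B $$ (i, k) = (if i = 0 then 1 else 0)" if "i < Suc k" for i
    using that A by (auto simp: B_def replace_col_def)
  moreover have "x $ k * det A = det B"
    using cramer_lemma_mat[OF A x, of k] sol by (simp add: B_def)
  moreover have "det B = (\<Sum>i<Suc k. B $$ (i, k) * cofactor B i k)"
    using laplace_expansion_column[OF B] by blast
  ultimately show ?thesis
    by (simp add: sum.lessThan_Suc_shift cofactor_def del: sum.lessThan_Suc)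
qed

definition shifted_lower_mat :: "nat \<Rightarrow> (nat \<Rightarrow> int \<Rightarrow> 'a::comm_ring_1) \<Rightarrow> nat \<Rightarrow> nat \<Rightarrow> 'a mat" where
  "shifted_lower_mat m l n k =
     mat k k (\<lambda>(i, j). if j \<le> i then l (n - j * m) (int i - int j) else 0)"

lemma det_shifted_lower_mat:
  "det (shifted_lower_mat m l n k) = (\<Prod>i<k. l (n - i * m) 0)"
proof -
  have "det (shifted_lower_mat m l n k) = prod_list (diag_mat (shifted_lower_mat m l n k))"
    by (rule det_lower_triangular[where n = k]) (auto simp: shifted_lower_mat_def)
  also have "diag_mat (shifted_lower_mat m l n k) = map (\<lambda>i. l (n - i * m) 0) [0..<k]"
    by (auto simp: diag_mat_def shifted_lower_mat_def)
  finally show ?thesis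
    by (simp add: prod.distinct_set_conv_list[symmetric] atLeast0LessThan)
qed

text \<open>Deleting row 0 moves every remaining row up by one, so the old diagonal becomes the
  superdiagonal; this accounts for the bound \<open>j \<le> i + 1\<close> and the index
  \<open>i - j + 1\<close> in \<open>hess_entry\<close>.\<close>

lemma mat_delete_shifted_lower_mat:
  "mat_delete (shifted_lower_mat m l n (Suc k)) 0 k = hess_mat m l n k"
  by (rule eq_matI) (auto simp: mat_delete_def shifted_lower_mat_def hess_mat_def hess_entry_def
      algebra_simps)

lemma prod_dvd_one:
  fixes f :: "'b \<Rightarrow> 'a::comm_ring_1"
  assumes "\<And>i. i \<in> S \<Longrightarrow> f i dvd 1"
  shows "prod f S dvd 1"
  using prod_dvd_prod[of S f "\<lambda>_. 1"] assms by simp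

lemma eq_unit_divideI:
  assumes "u dvd 1" and "x * u = y"
  shows "x = unit_divide y u"
proof -
  have "unit_divide y u = x * (u * unit_inv u)"
    by (simp add: unit_divide_def assms(2)[symmetric] mult.assoc)
  then show ?thesis by (simp add: unit_inv_right[OF assms(1)])
qed

theorem theorem2p13:
  fixes l1 :: "nat \<Rightarrow> int \<Rightarrow> 'a::comm_ring_1"
    and l3 :: "nat \<Rightarrow> nat \<Rightarrow> 'a"
    and m n :: nat
  assumes "m \<ge> 1"
    and "triangular_support m l1"
    and "\<And>t. 1 \<le> t \<Longrightarrow> t \<le> w m n \<Longrightarrow>
           (\<Sum>b = 0..t. l3 n b * l1 (n - m * b) (int t - int b)) = 0"
    and "l1 n 0 * l3 n 0 = 1"
    and "\<And>i. 1 \<le> i \<Longrightarrow> i \<le> w m n \<Longrightarrow> l1 (n - i * m) 0 dvd 1"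
  shows "\<forall>k. 1 \<le> k \<and> k \<le> w m n \<longrightarrow>
           l3 n k = (-1) ^ k * unit_divide (det (hess_mat m l1 n k)) (\<Prod>i = 0..k. l1 (n - i * m) 0)"
proof (intro allI impI)
  fix k assume k: "1 \<le> k \<and> k \<le> w m n"
  define L where "L = shifted_lower_mat m l1 n (Suc k)"
  define x where "x = vec (Suc k) (l3 n)"
  have L: "L \<in> carrier_mat (Suc k) (Suc k)" and x: "x \<in> carrier_vec (Suc k)"
    by (auto simp: L_def shifted_lower_mat_def x_def)
  have "L *\<^sub>v x = unit_vec (Suc k) 0"
  proof (rule eq_vecI)
    fix t assume "t < dim_vec (unit_vec (Suc k) 0 :: 'a vec)"
    then have t: "t < Suc k" by simp
    have "(L *\<^sub>v x) $ t =
        (\<Sum>b = 0..<Suc k. (if b \<le> t then l1 (n - b * m) (int t - int b) else 0) * l3 n b)"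
      using t by (simp add: L_def shifted_lower_mat_def x_def scalar_prod_def del: sum.op_ivl_Suc)
    also have "\<dots> = (\<Sum>b = 0..t. l3 n b * l1 (n - m * b) (int t - int b))"
      using t by (intro sum.mono_neutral_cong_right) (auto simp: mult.commute)
    \<comment> \<open>Row 0 is condition (b); row \<open>t\<close> with \<open>t \<ge> 1\<close> is
      condition (a), available since \<open>t \<le> k \<le> w m n\<close>.\<close>
    also have "\<dots> = (if t = 0 then 1 else 0)"
      using assms(3)[of t] assms(4) t k by (auto simp: mult.commute)
    finally show "(L *\<^sub>v x) $ t = unit_vec (Suc k) 0 $ t"
      using t by simp
  qed (use L in auto)
  from last_coordinate_of_unit_vec_solution[OF L x this]
  \<comment> \<open>\<open>L\<close> has size \<open>Suc k\<close>, so its determinant has one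
    factor more than the size of the Hessenberg minor.\<close>
  have eq: "l3 n k * (\<Prod>i = 0..k. l1 (n - i * m) 0) = (-1) ^ k * det (hess_mat m l1 n k)"
    by (simp add: L_def x_def det_shifted_lower_mat mat_delete_shifted_lower_mat
        lessThan_Suc_atMost atLeast0AtMost)
  \<comment> \<open>Condition (c) starts at \<open>i = 1\<close>; the factor for
    \<open>i = 0\<close> is a unit by (b).\<close>
  have "l1 n 0 dvd 1"
    using assms(4) by (metis dvd_triv_left)
  then have "l1 (n - i * m) 0 dvd 1" if "i \<le> k" for i
    using assms(5)[of i] k that by (cases "i = 0") auto
  then have "(\<Prod>i = 0..k. l1 (n - i * m) 0) dvd 1"
    by (intro prod_dvd_one) auto
  from eq_unit_divideI[OF this eq]
  show "l3 n k = (-1) ^ k * unit_divide (det (hess_mat m l1 n k)) (\<Prod>i = 0..k. l1 (n - i * m) 0)"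
    by (simp add: unit_divide_def mult.assoc)
qed

end
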